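(* Let $\mathcal{TCG}$ be the class of two-clique graphs. A graph limit belongs to $\widehat{\mathcal{TCG}}^{\max}$ if and only if it is represented by the graphon $W^1_a$ for some $a\in[0,1]$.
   Context: A two-clique graph is a finite graph that is the disjoint union of at most two cliques. A graphon is a measurable symmetric function $W:[0,1]^2\to[0,1]$; every graphon represents a graph limit (limit of a convergent graph sequence in the sense of Lovász–Szegedy), and every graph limit is represented by some graphon. The entropy of a graphon is $\int_0^1\int_0^1 h(W(x,y))\,dx\,dy$ with $h(x)=-x\log_2x-(1-x)\log_2(1-x)$. For a graph class $\mathcal{P}$, $\widehat{\mathcal{P}}$ is the set of graph limits of sequences $G_n\in\mathcal{P}$ with $|V(G_n)|\to\infty$, and $\widehat{\mathcal{P}}^{\max}$ is the set of elements of $\widehat{\mathcal{P}}$ of maximal entropy. For $a\in[0,1]$, $W^1_a$ is the graphon on $[0,1)^2$ equal to $1$ on $[0,a)^2\cup[a,1)^2$ and $0$ elsewhere. *)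

theory Defs
  imports "HOL-Probability.Probability" "Graph_Theory.Pair_Digraph"
begin

text \<open>
  A finite simple graph is a \<^const>\<open>pair_graph\<close>: a finite, loop-free, symmetric digraph, so that
  each undirected edge is the pair of arcs \<open>(u, v)\<close>, \<open>(v, u)\<close>. Vertices are natural numbers,
  which is no restriction up to isomorphism.
\<close>

definition finite_graphs :: "nat pair_pre_digraph set" where
  "finite_graphs = {G. pair_graph G}"

definition hom_density :: "nat pair_pre_digraph \<Rightarrow> nat pair_pre_digraph \<Rightarrow> real" where
  "hom_density F G =
     real (card {\<phi> \<in> pverts F \<rightarrow>\<^sub>E pverts G. \<forall>(u, v) \<in> parcs F. (\<phi> u, \<phi> v) \<in> parcs G})
       / real (card (pverts G)) ^ card (pverts F)"

text \<open>
  A graph limit is the family of limiting homomorphism densities of a convergent sequence of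
  graphs, i.e. a function of the test graph \<open>F\<close>; it is \<^const>\<open>extensional\<close> so that two graph
  limits are equal iff they have the same densities.
\<close>

definition class_limits ::
  "nat pair_pre_digraph set \<Rightarrow> (nat pair_pre_digraph \<Rightarrow> real) set" where
  "class_limits P = {\<Gamma> \<in> extensional finite_graphs.
     \<exists>G. (\<forall>n::nat. G n \<in> P) \<and>
         filterlim (\<lambda>n. card (pverts (G n))) at_top sequentially \<and>
         (\<forall>F \<in> finite_graphs. (\<lambda>n. hom_density F (G n)) \<longlonglongrightarrow> \<Gamma> F)}"

definition graph_limits :: "(nat pair_pre_digraph \<Rightarrow> real) set" where
  "graph_limits = class_limits finite_graphs"

definition unit_interval :: "real measure" where
  "unit_interval = restrict_space lborel {0..1}"

definition graphon :: "(real \<Rightarrow> real \<Rightarrow> real) \<Rightarrow> bool" where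
  "graphon W \<longleftrightarrow>
     (\<lambda>(x, y). W x y) \<in> borel_measurable (unit_interval \<Otimes>\<^sub>M unit_interval) \<and>
     (\<forall>x \<in> {0..1}. \<forall>y \<in> {0..1}. W x y = W y x \<and> W x y \<in> {0..1})"

text \<open>The condition \<open>u < v\<close> selects one of the two arcs of each undirected edge.\<close>

definition graphon_density ::
  "nat pair_pre_digraph \<Rightarrow> (real \<Rightarrow> real \<Rightarrow> real) \<Rightarrow> real" where
  "graphon_density F W =
     (\<integral>x. (\<Prod>(u, v) \<in> {(u, v). (u, v) \<in> parcs F \<and> u < v}. W (x u) (x v))
        \<partial>(PiM (pverts F) (\<lambda>_. unit_interval)))"

definition represents ::
  "(real \<Rightarrow> real \<Rightarrow> real) \<Rightarrow> (nat pair_pre_digraph \<Rightarrow> real) \<Rightarrow> bool" where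
  "represents W \<Gamma> \<longleftrightarrow> graphon W \<and> (\<forall>F \<in> finite_graphs. \<Gamma> F = graphon_density F W)"

text \<open>Since \<^term>\<open>log 2 0 = (0::real)\<close>, this has the intended value \<open>0\<close> at \<open>0\<close> and \<open>1\<close>.\<close>

definition binary_entropy :: "real \<Rightarrow> real" where
  "binary_entropy x = - x * log 2 x - (1 - x) * log 2 (1 - x)"

definition graphon_entropy :: "(real \<Rightarrow> real \<Rightarrow> real) \<Rightarrow> real" where
  "graphon_entropy W =
     (\<integral>x. (\<integral>y. binary_entropy (W x y) \<partial>unit_interval) \<partial>unit_interval)"

text \<open>
  The entropy of a graph limit is the common value of the entropies of all graphons
  representing it.
\<close>

definition limit_entropy :: "(nat pair_pre_digraph \<Rightarrow> real) \<Rightarrow> real" where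
  "limit_entropy \<Gamma> = (THE e. \<exists>W. represents W \<Gamma> \<and> e = graphon_entropy W)"

definition max_entropy_limits ::
  "nat pair_pre_digraph set \<Rightarrow> (nat pair_pre_digraph \<Rightarrow> real) set" where
  "max_entropy_limits P =
     {\<Gamma> \<in> class_limits P. \<forall>\<Delta> \<in> class_limits P. limit_entropy \<Delta> \<le> limit_entropy \<Gamma>}"

text \<open>\<open>A\<close> and \<open>B\<close> are the two cliques; either may be empty.\<close>

definition two_clique_graphs :: "nat pair_pre_digraph set" where
  "two_clique_graphs = {G \<in> finite_graphs.
     \<exists>A B. A \<inter> B = {} \<and> pverts G = A \<union> B \<and>
           parcs G = {(u, v). u \<noteq> v \<and> (u \<in> A \<and> v \<in> A \<or> u \<in> B \<and> v \<in> B)}}"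

definition two_clique_graphon :: "real \<Rightarrow> real \<Rightarrow> real \<Rightarrow> real" where
  "two_clique_graphon a x y = indicator ({0..<a} \<times> {0..<a} \<union> {a..<1} \<times> {a..<1}) (x, y)"

end

theory Submission
  imports Defs
begin

text \<open>
  Up to an error \<open>O(1/n)\<close> caused by non-injective maps, the density of \<open>F\<close> in a two-clique graph
  with a fraction \<open>a\<close> of its vertices in the first clique is a polynomial in \<open>a\<close>, and the same
  polynomial is the density of \<open>F\<close> in \<open>W\<^sup>1\<^sub>a\<close>. By compactness of \<open>[0,1]\<close>, the limits of two-clique
  graphs are therefore exactly the limits represented by some \<open>W\<^sup>1\<^sub>a\<close>. All of them have entropy \<open>0\<close>,
  so all are maximal: in any graphon representing such a limit, three random points almost surely
  induce neither exactly two edges nor none, which is a statement about densities of graphs on three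
  vertices, and this forces the graphon to take values in \<open>{0, 1}\<close> almost everywhere.
\<close>

section \<open>Split sets and the split polynomial of a test graph\<close>

text \<open>The vertex sets that \<open>F\<close> can send to the first clique: unions of components of \<open>F\<close>.\<close>

definition split_sets :: "nat pair_pre_digraph \<Rightarrow> nat set set" where
  "split_sets F = {S \<in> Pow (pverts F). \<forall>(u, v) \<in> parcs F. u \<in> S \<longleftrightarrow> v \<in> S}"

text \<open>The probability that every edge of \<open>F\<close> stays within one side when each
  vertex is put independently on the first side with probability \<open>a\<close>.\<close>

definition split_poly :: "nat pair_pre_digraph \<Rightarrow> real \<Rightarrow> real" where
  "split_poly F a = (\<Sum>S \<in> split_sets F. \<Prod>v \<in> pverts F. if v \<in> S then a else 1 - a)"

lemma finite_graphsD:
  assumes "F \<in> finite_graphs"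
  shows "finite (pverts F)" "finite (parcs F)"
    "(u, v) \<in> parcs F \<Longrightarrow> u \<in> pverts F" "(u, v) \<in> parcs F \<Longrightarrow> v \<in> pverts F"
    "(u, v) \<in> parcs F \<Longrightarrow> (v, u) \<in> parcs F" "(u, v) \<in> parcs F \<Longrightarrow> u \<noteq> v"
proof -
  interpret pair_graph F using assms by (simp add: finite_graphs_def)
  show "finite (pverts F)" "finite (parcs F)" by (fact pair_finite_verts, fact pair_finite_arcs)
  show "u \<in> pverts F" "v \<in> pverts F" "(v, u) \<in> parcs F" "u \<noteq> v" if "(u, v) \<in> parcs F"
    using that pair_sym_arcs pair_no_loops[OF that]
    by (auto dest: in_arcsD1 in_arcsD2 simp: symmetric_def sym_def)
qed

lemma finite_graphsI:
  assumes "finite V" "E \<subseteq> V \<times> V" "sym E" "irrefl E"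
  shows "\<lparr>pverts = V, parcs = E\<rparr> \<in> finite_graphs"
proof -
  have "finite E" using assms finite_subset by blast
  then show ?thesis
    unfolding finite_graphs_def mem_Collect_eq using assms
    by unfold_locales (auto simp: symmetric_def irrefl_def)
qed

lemma finite_split_sets: "F \<in> finite_graphs \<Longrightarrow> finite (split_sets F)"
  by (auto simp: split_sets_def finite_graphsD)

lemma isCont_split_poly: "F \<in> finite_graphs \<Longrightarrow> isCont (split_poly F) a"
  unfolding split_poly_def
proof (intro continuous_intros)
  show "isCont (\<lambda>x. if v \<in> S then x else 1 - x) a" for S :: "nat set" and v
    by (cases "v \<in> S") auto
qed

section \<open>Measure theory on the unit interval and its powers\<close>

interpretation unit_interval: prob_space unit_interval
proof
  show "emeasure unit_interval (space unit_interval) = 1"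
    by (simp add: unit_interval_def space_restrict_space emeasure_restrict_space)
qed

lemma space_unit_interval: "space unit_interval = {0..1}"
  by (simp add: unit_interval_def space_restrict_space)

lemma measurable_unit_interval_borel [measurable]: "(\<lambda>x. x) \<in> unit_interval \<rightarrow>\<^sub>M borel"
  unfolding unit_interval_def by (rule measurable_restrict_space1) simp

text \<open>The point 1 lies in \<open>unit_interval\<close> but in neither square of
  \<open>two_clique_graphon\<close>. Discarding this null set makes
  \<open>two_clique_graphon_eq\<close> available almost everywhere.\<close>

lemma AE_unit_interval_less_1: "AE x in unit_interval. 0 \<le> x \<and> x < 1"
proof -
  have "AE x in lborel. x \<noteq> (1::real)" by (rule AE_lborel_singleton)
  then have "AE x in lborel. x \<in> {0..1} \<longrightarrow> 0 \<le> x \<and> x < (1::real)" by eventually_elim auto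
  then show ?thesis
    unfolding unit_interval_def by (subst AE_restrict_space_iff) auto
qed

lemma integral_unit_interval_indicator:
  assumes "0 \<le> a" "b \<le> 1" "a \<le> b"
  shows "(\<integral>x. indicator {a..<b} x \<partial>unit_interval) = b - a"
proof -
  have "measure unit_interval {a..<b} = b - a"
    unfolding unit_interval_def using assms by (subst measure_restrict_space) auto
  moreover have "{a..<b} \<inter> {0..1} = {a..<b}" using assms by auto
  ultimately show ?thesis by (simp add: space_unit_interval)
qed

lemma integrable_unit_interval_indicator:
  "integrable unit_interval (\<lambda>x. indicator {a..<b::real} x :: real)"
  by (rule unit_interval.integrable_const_bound[where B = 1]) (auto simp: indicator_def)

lemma graphon_two_clique: "graphon (two_clique_graphon a)"
  unfolding graphon_def
proof (intro conjI ballI)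
  have "(\<lambda>z. (fst z, snd z)) \<in> unit_interval \<Otimes>\<^sub>M unit_interval \<rightarrow>\<^sub>M borel \<Otimes>\<^sub>M borel"
    by measurable
  moreover have "(\<lambda>z. indicator ({0..<a} \<times> {0..<a} \<union> {a..<1} \<times> {a..<1}) z :: real)
    \<in> borel_measurable (borel \<Otimes>\<^sub>M borel)"
    by measurable
  ultimately show "(\<lambda>(x, y). two_clique_graphon a x y)
      \<in> borel_measurable (unit_interval \<Otimes>\<^sub>M unit_interval)"
    unfolding two_clique_graphon_def case_prod_beta by (rule measurable_compose)
qed (auto simp: two_clique_graphon_def indicator_def)

lemma two_clique_graphon_eq:
  assumes "0 \<le> x" "x < 1" "0 \<le> y" "y < 1"
  shows "two_clique_graphon a x y = of_bool (x < a \<longleftrightarrow> y < a)"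
  using assms by (auto simp: two_clique_graphon_def indicator_def)

abbreviation cube :: "nat set \<Rightarrow> (nat \<Rightarrow> real) measure" where
  "cube V \<equiv> PiM V (\<lambda>_. unit_interval)"

lemma prob_space_cube: "prob_space (cube V)"
  by (intro prob_space_PiM unit_interval.prob_space_axioms)

lemma AE_cube_less_1:
  assumes "finite V"
  shows "AE x in cube V. \<forall>v \<in> V. 0 \<le> x v \<and> x v < 1"
  using assms
  by (intro AE_finite_allI AE_PiM_component unit_interval.prob_space_axioms AE_unit_interval_less_1)

lemma measurable_graphon_cube:
  assumes "graphon W" "u \<in> V" "v \<in> V"
  shows "(\<lambda>x. W (x u) (x v)) \<in> borel_measurable (cube V)"
proof -
  have "(\<lambda>x. (x u, x v)) \<in> cube V \<rightarrow>\<^sub>M unit_interval \<Otimes>\<^sub>M unit_interval"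
    using assms by measurable
  moreover have "(\<lambda>(x, y). W x y) \<in> borel_measurable (unit_interval \<Otimes>\<^sub>M unit_interval)"
    using assms by (simp add: graphon_def)
  ultimately show ?thesis by (auto dest: measurable_compose)
qed

lemma of_bool_Ball_eq_prod:
  "finite X \<Longrightarrow> of_bool (\<forall>e \<in> X. P e) = (\<Prod>e \<in> X. of_bool (P e) :: 'a :: comm_semiring_1)"
  by (induction X rule: finite_induct) (simp_all add: of_bool_conj split del: split_of_bool)

section \<open>Densities in the two-clique graphon\<close>

text \<open>For almost every point \<open>x\<close> the integrand is 1 or 0 according to whether the
  set of vertices \<open>v\<close> with \<open>x v < a\<close> is a split set. Summing over the
  possible split sets turns it into products of one-variable indicators, whose integrals factorise
  into lengths \<open>a\<close> and \<open>1 - a\<close>.\<close>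

lemma graphon_density_two_clique:
  assumes F: "F \<in> finite_graphs" and a: "a \<in> {0..1}"
  shows "graphon_density F (two_clique_graphon a) = split_poly F a"
proof -
  interpret product_sigma_finite "\<lambda>_::nat. unit_interval" ..
  define V where "V = pverts F"
  define E where "E = {(u, v). (u, v) \<in> parcs F \<and> u < v}"
  have fin: "finite V" using finite_graphsD[OF F] by (simp add: V_def)
  have E_sub: "E \<subseteq> V \<times> V" using finite_graphsD[OF F] by (auto simp: V_def E_def)
  then have finE: "finite E" using fin finite_subset by blast
  \<comment> \<open>The density uses one arc per edge. Since \<open>F\<close> is symmetric and
    loop-free, the split condition can be tested on these arcs alone.\<close>
  have split: "S \<in> split_sets F \<longleftrightarrow> S \<subseteq> V \<and> (\<forall>(u, v) \<in> E. u \<in> S \<longleftrightarrow> v \<in> S)" for S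
    unfolding split_sets_def V_def E_def using finite_graphsD(5,6)[OF F]
    by (auto, (metis linorder_neqE_nat)+)
  define f :: "nat set \<Rightarrow> nat \<Rightarrow> real \<Rightarrow> real" where
    "f S v = (if v \<in> S then indicator {0..<a} else indicator {a..<1})" for S v
  have f_int: "integrable unit_interval (f S v)" for S v
    by (simp add: f_def integrable_unit_interval_indicator)
  have point: "(\<Prod>(u, v) \<in> E. two_clique_graphon a (x u) (x v))
      = (\<Sum>S \<in> split_sets F. \<Prod>v \<in> V. f S v (x v))"
    if x: "\<forall>v \<in> V. 0 \<le> x v \<and> x v < 1" for x
  proof -
    define T where "T = {v \<in> V. x v < a}"
    \<comment> \<open>The factor \<open>f S v\<close> tests whether \<open>x v\<close> lies on the
      side that \<open>S\<close> prescribes for \<open>v\<close>, so a vertex on which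
      \<open>S\<close> and \<open>T\<close> disagree kills the product.\<close>
    have "(\<Prod>v \<in> V. f S v (x v)) = of_bool (S = T)" if "S \<in> split_sets F" for S
    proof (cases "S = T")
      case True
      then show ?thesis
        using x by (auto intro!: prod.neutral simp: f_def T_def)
    next
      case False
      moreover have "S \<subseteq> V" "T \<subseteq> V" using that by (auto simp: split T_def)
      ultimately obtain v where "v \<in> V" "v \<in> S \<longleftrightarrow> v \<notin> T" by blast
      then have "v \<in> V" "f S v (x v) = 0" using x by (auto simp: f_def T_def)
      then show ?thesis using False fin by (auto intro: prod_zero)
    qed
    then have "(\<Sum>S \<in> split_sets F. \<Prod>v \<in> V. f S v (x v)) = of_bool (T \<in> split_sets F)"
      using finite_split_sets[OF F] by simp
    also have "\<dots> = of_bool (\<forall>(u, v) \<in> E. u \<in> T \<longleftrightarrow> v \<in> T)"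
      by (auto simp: split T_def)
    also have "\<dots> = (\<Prod>(u, v) \<in> E. of_bool (u \<in> T \<longleftrightarrow> v \<in> T))"
      unfolding case_prod_beta by (rule of_bool_Ball_eq_prod[OF finE])
    also have "\<dots> = (\<Prod>(u, v) \<in> E. two_clique_graphon a (x u) (x v))"
    proof (intro prod.cong refl)
      fix e assume "e \<in> E"
      then obtain u v where e: "e = (u, v)" "u \<in> V" "v \<in> V" using E_sub by auto
      then show "(case e of (u, v) \<Rightarrow> of_bool (u \<in> T \<longleftrightarrow> v \<in> T))
          = (case e of (u, v) \<Rightarrow> two_clique_graphon a (x u) (x v))"
        using x by (simp add: T_def two_clique_graphon_eq)
    qed
    finally show ?thesis by simp
  qed
  have [measurable]: "(\<lambda>x. \<Prod>(u, v) \<in> E. two_clique_graphon a (x u) (x v)) \<in> borel_measurable (cube V)"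
    unfolding case_prod_beta using E_sub
    by (intro borel_measurable_prod measurable_graphon_cube graphon_two_clique) auto
  have f_prod_int: "integrable (cube V) (\<lambda>x. \<Prod>v \<in> V. f S v (x v))" for S
    by (rule product_integrable_prod[OF fin f_int])
  have "graphon_density F (two_clique_graphon a)
      = (\<integral>x. (\<Prod>(u, v) \<in> E. two_clique_graphon a (x u) (x v)) \<partial>cube V)"
    by (simp add: graphon_density_def V_def E_def)
  also have "\<dots> = (\<integral>x. (\<Sum>S \<in> split_sets F. \<Prod>v \<in> V. f S v (x v)) \<partial>cube V)"
  proof (rule integral_cong_AE)
    show "(\<lambda>x. \<Sum>S \<in> split_sets F. \<Prod>v \<in> V. f S v (x v)) \<in> borel_measurable (cube V)"
      using f_prod_int by (intro borel_measurable_sum borel_measurable_integrable)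
    show "AE x in cube V. (\<Prod>(u, v) \<in> E. two_clique_graphon a (x u) (x v))
        = (\<Sum>S \<in> split_sets F. \<Prod>v \<in> V. f S v (x v))"
      using AE_cube_less_1[OF fin] by eventually_elim (rule point)
  qed measurable
  also have "\<dots> = (\<Sum>S \<in> split_sets F. \<integral>x. (\<Prod>v \<in> V. f S v (x v)) \<partial>cube V)"
    by (rule Bochner_Integration.integral_sum[OF f_prod_int])
  also have "\<dots> = (\<Sum>S \<in> split_sets F. \<Prod>v \<in> V. integral\<^sup>L unit_interval (f S v))"
    by (simp add: product_integral_prod[OF fin f_int])
  also have "\<dots> = split_poly F a"
    unfolding split_poly_def V_def f_def
    using a integral_unit_interval_indicator[of 0 a] integral_unit_interval_indicator[of a 1]
    by (intro sum.cong prod.cong refl) simp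
  finally show ?thesis .
qed

section \<open>Densities in finite two-clique graphs\<close>

text \<open>If adjacent vertices were also allowed to share an image, the count of maps would be
  given exactly by the split polynomial. The maps this adds identify two distinct vertices of
  \<open>F\<close>, and with \<open>k\<close> and \<open>n\<close> the orders of \<open>F\<close>
  and \<open>G\<close> there are at most \<open>k\<^sup>2 * n ^ (k - 1)\<close> of them among
  \<open>n ^ k\<close>.\<close>

lemma hom_density_two_clique:
  assumes F: "F \<in> finite_graphs" and V: "finite (pverts G)" "pverts G \<noteq> {}"
    and AB: "A \<inter> B = {}" "pverts G = A \<union> B"
    and arcs: "parcs G = {(u, v). u \<noteq> v \<and> (u \<in> A \<and> v \<in> A \<or> u \<in> B \<and> v \<in> B)}"
  shows "\<bar>hom_density F G - split_poly F (card A / card (pverts G))\<bar>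
      \<le> (card (pverts F))\<^sup>2 / card (pverts G)"
proof -
  define n where "n = card (pverts G)"
  define U where "U = pverts F"
  define k where "k = card U"
  have n: "n > 0" using V by (simp add: n_def card_gt_0_iff)
  have finU: "finite U" using finite_graphsD[OF F] by (simp add: U_def)
  have finAB: "finite A" "finite B" using V AB by auto
  have card_AB: "card B = n - card A" "card A \<le> n"
    using AB finAB by (auto simp: n_def card_Un_disjoint)
  define H where "H = {\<phi> \<in> U \<rightarrow>\<^sub>E pverts G. \<forall>(u, v) \<in> parcs F. (\<phi> u, \<phi> v) \<in> parcs G}"
  \<comment> \<open>These are the homomorphisms into \<open>G\<close> with a loop added at every
    vertex; \<open>H\<close> holds those into \<open>G\<close> itself.\<close>
  define K where "K = {\<phi> \<in> U \<rightarrow>\<^sub>E pverts G. \<forall>(u, v) \<in> parcs F. \<phi> u \<in> A \<longleftrightarrow> \<phi> v \<in> A}"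
  define C where "C S = (\<Pi>\<^sub>E v \<in> U. if v \<in> S then A else B)" for S
  have finM: "finite (U \<rightarrow>\<^sub>E pverts G)" by (intro finite_PiE finU V)
  \<comment> \<open>Maps are sorted by the preimage of \<open>A\<close>, which is a split set; once
    it is fixed, the values are chosen independently in \<open>A\<close> or
    \<open>B\<close>.\<close>
  have "K = (\<Union>S \<in> split_sets F. C S)"
  proof (intro equalityI subsetI)
    fix \<phi> assume \<phi>: "\<phi> \<in> K"
    then have "{v \<in> U. \<phi> v \<in> A} \<in> split_sets F"
      using finite_graphsD(3,4)[OF F] by (auto simp: K_def split_sets_def U_def)
    moreover have "\<phi> \<in> C {v \<in> U. \<phi> v \<in> A}"
      using \<phi> AB by (auto simp: K_def C_def PiE_iff)
    ultimately show "\<phi> \<in> (\<Union>S \<in> split_sets F. C S)" by blast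
  next
    fix \<phi> assume "\<phi> \<in> (\<Union>S \<in> split_sets F. C S)"
    then obtain S where S: "S \<in> split_sets F" "\<phi> \<in> C S" by blast
    then have *: "\<phi> v \<in> A \<longleftrightarrow> v \<in> S" "\<phi> v \<in> pverts G" if "v \<in> U" for v
      using AB that by (fastforce simp: C_def PiE_iff split: if_splits)+
    have "\<phi> \<in> extensional U" using S by (simp add: C_def PiE_iff)
    with * S(1) show "\<phi> \<in> K"
      using finite_graphsD(3,4)[OF F] by (fastforce simp: K_def split_sets_def PiE_iff U_def)
  qed
  moreover have "C S \<inter> C T = {}" if "S \<in> split_sets F" "T \<in> split_sets F" "S \<noteq> T" for S T
  proof -
    from that obtain v where "v \<in> U" "v \<in> S \<longleftrightarrow> v \<notin> T" by (auto simp: split_sets_def U_def)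
    then show ?thesis using AB by (fastforce simp: C_def PiE_iff split: if_splits)
  qed
  moreover have "finite (C S)" for S
    unfolding C_def using finU finAB by (intro finite_PiE) auto
  ultimately have "card K = (\<Sum>S \<in> split_sets F. card (C S))"
    using finite_split_sets[OF F] by (simp add: card_UN_disjoint)
  also have "\<dots> = (\<Sum>S \<in> split_sets F. \<Prod>v \<in> U. if v \<in> S then card A else card B)"
    unfolding C_def using finU by (simp add: card_PiE if_distrib)
  finally have "real (card K) / n ^ k
      = (\<Sum>S \<in> split_sets F. \<Prod>v \<in> U. real (if v \<in> S then card A else card B) / n)"
    by (simp add: sum_divide_distrib prod_dividef k_def)
  also have "\<dots> = split_poly F (card A / n)"
    unfolding split_poly_def U_def using n card_AB
    by (intro sum.cong prod.cong refl) (auto simp: field_simps of_nat_diff)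
  finally have K: "real (card K) / n ^ k = split_poly F (card A / n)" .
  define D where "D e = {\<phi> \<in> U \<rightarrow>\<^sub>E pverts G. \<phi> (fst e) = \<phi> (snd e)}" for e
  have D: "card (D e) \<le> n ^ (k - 1)" if e: "e \<in> U \<times> U - Id" for e
  proof -
    obtain u v where uv: "e = (u, v)" "u \<in> U" "v \<in> U" "u \<noteq> v" using e by auto
    \<comment> \<open>A map in \<open>D e\<close> is determined by its values away from
      \<open>v\<close>, as its value at \<open>v\<close> repeats the one at
      \<open>u\<close>.\<close>
    have "inj_on (\<lambda>\<phi>. restrict \<phi> (U - {v})) (D e)"
    proof (rule inj_onI)
      fix \<phi> \<psi> assume \<phi>: "\<phi> \<in> D e" and \<psi>: "\<psi> \<in> D e"
        and eq: "restrict \<phi> (U - {v}) = restrict \<psi> (U - {v})"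
      have *: "\<phi> w = \<psi> w" if "w \<in> U - {v}" for w using fun_cong[OF eq, of w] that by simp
      then have "\<phi> v = \<psi> v" using *[of u] uv \<phi> \<psi> by (simp add: D_def)
      with * \<phi> \<psi> show "\<phi> = \<psi>"
        by (intro PiE_ext[of \<phi> U "\<lambda>_. pverts G"]) (auto simp: D_def)
    qed
    moreover have "(\<lambda>\<phi>. restrict \<phi> (U - {v})) ` D e \<subseteq> (U - {v}) \<rightarrow>\<^sub>E pverts G"
      by (auto simp: D_def PiE_iff extensional_def split: if_splits)
    ultimately have "card (D e) \<le> card ((U - {v}) \<rightarrow>\<^sub>E pverts G)"
      using finU V by (intro card_inj_on_le finite_PiE) auto
    also have "\<dots> = n ^ (k - 1)"
      using finU uv by (simp add: card_PiE n_def k_def)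
    finally show ?thesis .
  qed
  have HK: "H \<subseteq> K"
    unfolding H_def K_def arcs using AB by auto
  \<comment> \<open>Distinct vertices on the same side are adjacent, so an arc that fails to be
    preserved by a map in \<open>K\<close> must be collapsed to a point.\<close>
  have "K - H \<subseteq> (\<Union>e \<in> U \<times> U - Id. D e)"
  proof
    fix \<phi> assume \<phi>: "\<phi> \<in> K - H"
    then obtain u v where uv: "(u, v) \<in> parcs F" "(\<phi> u, \<phi> v) \<notin> parcs G"
      by (auto simp: K_def H_def)
    have "u \<in> U" "v \<in> U" "u \<noteq> v" using finite_graphsD[OF F] uv by (auto simp: U_def)
    moreover have "\<phi> u = \<phi> v"
    proof -
      have "\<phi> u \<in> A \<longleftrightarrow> \<phi> v \<in> A" "\<phi> u \<in> A \<union> B" "\<phi> v \<in> A \<union> B"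
        using \<phi> uv \<open>u \<in> U\<close> \<open>v \<in> U\<close> AB by (auto simp: K_def PiE_iff)
      then show ?thesis using uv by (auto simp: arcs)
    qed
    ultimately show "\<phi> \<in> (\<Union>e \<in> U \<times> U - Id. D e)"
      using \<phi> by (auto simp: D_def K_def intro!: bexI[of _ "(u, v)"])
  qed
  then have "card (K - H) \<le> card (\<Union>e \<in> U \<times> U - Id. D e)"
    using finM finU by (intro card_mono finite_UN_I) (auto simp: D_def)
  also have "\<dots> \<le> (\<Sum>e \<in> U \<times> U - Id. card (D e))"
    using finU by (intro card_UN_le) auto
  also have "\<dots> \<le> (\<Sum>e \<in> U \<times> U - Id. n ^ (k - 1))"
    by (intro sum_mono D)
  also have "\<dots> \<le> k\<^sup>2 * n ^ (k - 1)"
    using finU card_mono[of "U \<times> U" "U \<times> U - Id"]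
    by (simp add: card_cartesian_product k_def power2_eq_square)
  finally have diff: "card (K - H) \<le> k\<^sup>2 * n ^ (k - 1)" .
  have "finite K" using finM by (auto simp: K_def)
  then have card_KH: "card (K - H) = card K - card H" "card H \<le> card K"
    using HK by (auto intro: card_Diff_subset card_mono finite_subset)
  have "hom_density F G = real (card H) / n ^ k"
    by (simp add: hom_density_def H_def U_def n_def k_def)
  then have "\<bar>hom_density F G - split_poly F (card A / n)\<bar> = real (card (K - H)) / n ^ k"
    unfolding K[symmetric] using card_KH
    by (simp add: of_nat_diff flip: diff_divide_distrib)
  also have "\<dots> \<le> real (k\<^sup>2 * n ^ (k - 1)) / n ^ k"
    using diff by (intro divide_right_mono) (auto simp del: of_nat_mult of_nat_power)
  \<comment> \<open>For \<open>k = 0\<close> the exponent \<open>k - 1\<close> truncates to 0, but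
    the factor \<open>k\<^sup>2\<close> makes both sides vanish.\<close>
  also have "\<dots> = k\<^sup>2 / n"
    using n by (cases "k = 0") (simp_all add: power_eq_if[of "real n" k])
  finally show ?thesis by (simp add: n_def k_def U_def)
qed

section \<open>Random triples of points of a graphon\<close>

text \<open>Isolated vertices are kept, so that the densities for all \<open>X\<close> are integrals
  over the same cube and can be combined linearly.\<close>

definition triple_graph :: "(nat \<times> nat) set \<Rightarrow> nat pair_pre_digraph" where
  "triple_graph X = \<lparr>pverts = {0, 1, 2}, parcs = X \<union> X\<inverse>\<rparr>"

definition triple_arcs :: "(nat \<times> nat) set" where
  "triple_arcs = {(0, 1), (0, 2), (1, 2)}"

lemma triple_arcs_less: "(u, v) \<in> triple_arcs \<Longrightarrow> u < v"
  by (auto simp: triple_arcs_def)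

lemma symmetric_closure_finite_graph:
  assumes "finite V" "X \<subseteq> V \<times> V" "irrefl X"
  shows "\<lparr>pverts = V, parcs = X \<union> X\<inverse>\<rparr> \<in> finite_graphs"
  using assms by (intro finite_graphsI) (auto simp: sym_def irrefl_def)

lemma triple_graph_finite:
  assumes "X \<subseteq> triple_arcs"
  shows "triple_graph X \<in> finite_graphs"
  unfolding triple_graph_def
proof (rule symmetric_closure_finite_graph)
  have "triple_arcs \<subseteq> {0, 1, 2} \<times> {0, 1, 2}" by (simp add: triple_arcs_def)
  with assms show "X \<subseteq> {0, 1, 2} \<times> {0, 1, 2}" by (rule order_trans)
  show "irrefl X" using assms triple_arcs_less unfolding irrefl_def by blast
qed simp

lemma graphon_density_triple:
  assumes "X \<subseteq> triple_arcs"
  shows "graphon_density (triple_graph X) W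
    = (\<integral>x. (\<Prod>(u, v) \<in> X. W (x u) (x v)) \<partial>cube {0, 1, 2})"
proof -
  have "{(u, v). (u, v) \<in> parcs (triple_graph X) \<and> u < v} = X"
    using assms triple_arcs_less by (fastforce simp: triple_graph_def)
  then show ?thesis by (simp add: graphon_density_def triple_graph_def)
qed

text \<open>
  The probability that three vertices, joined independently with probabilities \<open>p\<close>, \<open>q\<close>, \<open>r\<close>,
  span exactly two edges or none: the induced subgraphs that two-clique graphs avoid.
\<close>

definition bad_triple :: "real \<Rightarrow> real \<Rightarrow> real \<Rightarrow> real" where
  "bad_triple p q r =
     p * q * (1 - r) + p * r * (1 - q) + q * r * (1 - p) + (1 - p) * (1 - q) * (1 - r)"

lemma bad_triple_nonneg:
  assumes "p \<in> {0..1}" "q \<in> {0..1}" "r \<in> {0..1}"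
  shows "0 \<le> bad_triple p q r"
  using assms unfolding bad_triple_def by (intro add_nonneg_nonneg mult_nonneg_nonneg) auto

text \<open>All four summands vanish. If \<open>p\<close> were strictly between 0 and 1, the last
  two would force one of \<open>q\<close>, \<open>r\<close> to be 0 and the other to be 1, and then
  one of the first two would be positive.\<close>

lemma bad_triple_eq_0D:
  assumes "p \<in> {0..1}" "q \<in> {0..1}" "r \<in> {0..1}" "bad_triple p q r = 0"
  shows "p \<in> {0, 1}"
proof -
  have sum_0: "a = 0 \<and> b = 0 \<and> c = 0 \<and> d = 0"
    if "0 \<le> a" "0 \<le> b" "0 \<le> c" "0 \<le> d" "a + b + c + d = 0" for a b c d :: real
    using that by linarith
  have "p * q * (1 - r) = 0 \<and> p * r * (1 - q) = 0 \<and> q * r * (1 - p) = 0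
      \<and> (1 - p) * (1 - q) * (1 - r) = 0"
    using assms by (intro sum_0) (auto simp: bad_triple_def intro!: mult_nonneg_nonneg)
  then have "(p = 0 \<or> q = 0 \<or> r = 1) \<and> (p = 0 \<or> r = 0 \<or> q = 1) \<and> (q = 0 \<or> r = 0 \<or> p = 1)
      \<and> (p = 1 \<or> q = 1 \<or> r = 1)"
    by simp
  then show ?thesis by (metis insert_iff zero_neq_one)
qed

text \<open>Expanding \<open>bad_triple\<close> into monomials gives one density of a three-vertex
  graph per monomial. Hence graphons representing the same limit have the same integral.\<close>

lemma integral_bad_triple:
  assumes W: "graphon W"
  shows "integrable (cube {0, 1, 2})
      (\<lambda>x. bad_triple (W (x 0) (x 1)) (W (x 0) (x 2)) (W (x 1) (x 2)))" (is ?int)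
    and "(\<integral>x. bad_triple (W (x 0) (x 1)) (W (x 0) (x 2)) (W (x 1) (x 2)) \<partial>cube {0, 1, 2}) =
      graphon_density (triple_graph {}) W
      - graphon_density (triple_graph {(0, 1)}) W
      - graphon_density (triple_graph {(0, 2)}) W
      - graphon_density (triple_graph {(1, 2)}) W
      + 2 * graphon_density (triple_graph {(0, 1), (0, 2)}) W
      + 2 * graphon_density (triple_graph {(0, 1), (1, 2)}) W
      + 2 * graphon_density (triple_graph {(0, 2), (1, 2)}) W
      - 4 * graphon_density (triple_graph {(0, 1), (0, 2), (1, 2)}) W" (is ?eq)
proof -
  let ?M = "cube {0, 1, 2}"
  interpret prob_space ?M by (rule prob_space_cube)
  define g where "g X x = (\<Prod>(u, v) \<in> X. W (x u) (x v))" for X and x :: "nat \<Rightarrow> real"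
  have g_int: "integrable ?M (g X)" if "X \<subseteq> triple_arcs" for X
  proof (rule integrable_const_bound[where B = 1])
    show "g X \<in> borel_measurable ?M"
      unfolding g_def case_prod_beta using that
      by (intro borel_measurable_prod measurable_graphon_cube W) (auto simp: triple_arcs_def)
    show "AE x in ?M. norm (g X x) \<le> 1"
    proof (rule AE_I2)
      fix x assume "x \<in> space ?M"
      then have "x u \<in> {0..1}" if "u \<in> {0, 1, 2}" for u
        using that by (auto simp: space_PiM PiE_iff space_unit_interval)
      then have "W (x u) (x v) \<in> {0..1}" if "(u, v) \<in> X" for u v
        using W that \<open>X \<subseteq> triple_arcs\<close> unfolding graphon_def triple_arcs_def by blast
      then have "0 \<le> g X x" "g X x \<le> 1"
        unfolding g_def by (force intro!: prod_nonneg prod_le_1)+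
      then show "norm (g X x) \<le> 1" by simp
    qed
  qed
  have *: "(\<lambda>x. bad_triple (W (x 0) (x 1)) (W (x 0) (x 2)) (W (x 1) (x 2))) =
      (\<lambda>x. g {} x - g {(0, 1)} x - g {(0, 2)} x - g {(1, 2)} x + 2 * g {(0, 1), (0, 2)} x
        + 2 * g {(0, 1), (1, 2)} x + 2 * g {(0, 2), (1, 2)} x
        - 4 * g {(0, 1), (0, 2), (1, 2)} x)"
    by (rule ext) (simp add: bad_triple_def g_def algebra_simps)
  show ?int
    unfolding * using g_int by (simp add: triple_arcs_def)
  have "graphon_density (triple_graph X) W = integral\<^sup>L ?M (g X)" if "X \<subseteq> triple_arcs" for X
    unfolding g_def by (rule graphon_density_triple[OF that])
  then show ?eq
    unfolding * using g_int by (simp add: triple_arcs_def)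
qed

section \<open>Vanishing of the entropy\<close>

text \<open>The unconstrained third coordinate contributes a factor 1 to the measure of a box. This
  carries almost-everywhere statements from triples to pairs.\<close>

lemma distr_cube_pair:
  "distr (cube {0, 1, 2}) (unit_interval \<Otimes>\<^sub>M unit_interval) (\<lambda>x. (x 0, x 1))
    = unit_interval \<Otimes>\<^sub>M unit_interval"
proof -
  interpret product_sigma_finite "\<lambda>_::nat. unit_interval" ..
  have [measurable]: "(\<lambda>x. (x 0, x 1)) \<in> cube {0, 1, 2} \<rightarrow>\<^sub>M unit_interval \<Otimes>\<^sub>M unit_interval"
    by measurable
  show ?thesis
  proof (rule pair_measure_eqI[symmetric])
    fix A B assume AB: "A \<in> sets unit_interval" "B \<in> sets unit_interval"
    let ?X = "\<lambda>i::nat. if i = 0 then A else if i = 1 then B else space unit_interval"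
    have "emeasure (distr (cube {0, 1, 2}) (unit_interval \<Otimes>\<^sub>M unit_interval) (\<lambda>x. (x 0, x 1))) (A \<times> B)
        = emeasure (cube {0, 1, 2}) ((\<lambda>x. (x 0, x 1)) -` (A \<times> B) \<inter> space (cube {0, 1, 2}))"
      using AB by (subst emeasure_distr) auto
    also have "(\<lambda>x. (x 0, x 1)) -` (A \<times> B) \<inter> space (cube {0, 1, 2}) = (\<Pi>\<^sub>E i \<in> {0, 1, 2}. ?X i)"
    proof -
      have "A \<subseteq> space unit_interval" "B \<subseteq> space unit_interval"
        using AB by (auto dest: sets.sets_into_space)
      then show ?thesis by (simp add: space_PiM PiE_iff set_eq_iff) blast
    qed
    also have "emeasure (cube {0, 1, 2}) \<dots> = (\<Prod>i \<in> {0, 1, 2}. emeasure unit_interval (?X i))"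
      using AB by (intro emeasure_PiM) auto
    also have "\<dots> = emeasure unit_interval A * emeasure unit_interval B"
      by (simp add: unit_interval.emeasure_space_1)
    finally show "emeasure unit_interval A * emeasure unit_interval B
      = emeasure (distr (cube {0, 1, 2}) (unit_interval \<Otimes>\<^sub>M unit_interval) (\<lambda>x. (x 0, x 1))) (A \<times> B)"
      by simp
  qed (simp_all add: unit_interval.sigma_finite_measure_axioms)
qed

lemma graphon_entropy_eq_0:
  assumes "AE z in unit_interval \<Otimes>\<^sub>M unit_interval. W (fst z) (snd z) \<in> {0, 1}"
  shows "graphon_entropy W = 0"
proof -
  interpret pair_sigma_finite unit_interval unit_interval ..
  have "AE x in unit_interval. AE y in unit_interval. W x y \<in> {0, 1}"
    using AE_pair[OF assms] by simp
  then have "AE x in unit_interval. AE y in unit_interval. binary_entropy (W x y) = 0"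
    by (rule AE_mp) (auto simp: binary_entropy_def)
  then have "AE x in unit_interval. (\<integral>y. binary_entropy (W x y) \<partial>unit_interval) = 0"
    by (rule AE_mp) (auto intro: integral_eq_zero_AE)
  then show ?thesis
    unfolding graphon_entropy_def by (rule integral_eq_zero_AE)
qed

text \<open>The integral of \<open>bad_triple\<close> depends only on \<Gamma>, so it can be
  computed from \<open>two_clique_graphon a\<close>, where it is 0. For \<open>W\<close> the
  integrand is nonnegative, hence 0 almost everywhere, which makes \<open>W\<close> almost
  everywhere 0 or 1.\<close>

lemma graphon_entropy_represents_two_clique:
  assumes a: "represents (two_clique_graphon a) \<Gamma>" and W: "represents W \<Gamma>"
  shows "graphon_entropy W = 0"
proof -
  let ?M = "cube {0, 1, 2}"
  let ?B = "\<lambda>W x. bad_triple (W (x 0) (x 1)) (W (x 0) (x 2)) (W (x 1) (x 2))"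
  have gW: "graphon W" using W by (simp add: represents_def)
  have "graphon_density (triple_graph X) W = graphon_density (triple_graph X) (two_clique_graphon a)"
    if "X \<subseteq> triple_arcs" for X
    using a W triple_graph_finite[OF that] by (simp add: represents_def)
  then have "integral\<^sup>L ?M (?B W) = integral\<^sup>L ?M (?B (two_clique_graphon a))"
    unfolding integral_bad_triple(2)[OF gW] integral_bad_triple(2)[OF graphon_two_clique]
    by (simp add: triple_arcs_def)
  also have "\<dots> = 0"
  proof (rule integral_eq_zero_AE)
    \<comment> \<open>Lying on the same side of \<open>a\<close> is an equivalence relation with at
      most two classes, so three points have exactly one or three related pairs.\<close>
    have "AE x in ?M. \<forall>v \<in> {0, 1, 2}. 0 \<le> x v \<and> x v < 1" by (rule AE_cube_less_1) simp
    then show "AE x in ?M. ?B (two_clique_graphon a) x = 0"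
      by eventually_elim (auto simp: two_clique_graphon_eq bad_triple_def)
  qed
  finally have int0: "integral\<^sup>L ?M (?B W) = 0" .
  have W01: "W (x u) (x v) \<in> {0..1}" if "x \<in> space ?M" "u \<in> {0, 1, 2}" "v \<in> {0, 1, 2}" for x u v
  proof -
    have "x u \<in> {0..1}" "x v \<in> {0..1}"
      using that by (auto simp: space_PiM PiE_iff space_unit_interval)
    then show ?thesis using gW unfolding graphon_def by blast
  qed
  have "AE x in ?M. ?B W x = 0"
    using int0 integral_bad_triple(1)[OF gW]
    by (subst (asm) integral_nonneg_eq_0_iff_AE) (auto intro!: AE_I2 bad_triple_nonneg W01)
  then have AE01: "AE x in ?M. W (x 0) (x 1) \<in> {0, 1}"
  proof (rule AE_mp, intro AE_I2 impI)
    fix x assume "x \<in> space ?M" "?B W x = 0"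
    then show "W (x 0) (x 1) \<in> {0, 1}" by (intro bad_triple_eq_0D[OF W01 W01 W01]) auto
  qed
  have [measurable]: "(\<lambda>z. W (fst z) (snd z)) \<in> borel_measurable (unit_interval \<Otimes>\<^sub>M unit_interval)"
    using gW unfolding graphon_def case_prod_beta by simp
  have "AE z in distr ?M (unit_interval \<Otimes>\<^sub>M unit_interval) (\<lambda>x. (x 0, x 1)). W (fst z) (snd z) \<in> {0, 1}"
    using AE01 by (subst AE_distr_iff) auto
  then show ?thesis
    unfolding distr_cube_pair by (rule graphon_entropy_eq_0)
qed

text \<open>The description \<open>THE\<close> is well defined here:
  \<open>two_clique_graphon a\<close> provides a representing graphon, and every representing
  graphon has entropy 0.\<close>

lemma limit_entropy_two_clique:
  assumes "represents (two_clique_graphon a) \<Gamma>"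
  shows "limit_entropy \<Gamma> = 0"
  unfolding limit_entropy_def
  using assms graphon_entropy_represents_two_clique[OF assms]
  by (intro the_equality) (auto intro!: exI[of _ "two_clique_graphon a"])

section \<open>Limits of sequences of two-clique graphs\<close>

lemma tendsto_hom_density_two_clique:
  assumes F: "F \<in> finite_graphs"
    and G: "\<And>n. A n \<inter> B n = {}" "\<And>n. pverts (G n) = A n \<union> B n"
      "\<And>n. parcs (G n) = {(u, v). u \<noteq> v \<and> (u \<in> A n \<and> v \<in> A n \<or> u \<in> B n \<and> v \<in> B n)}"
    and card: "filterlim (\<lambda>n. card (pverts (G n))) at_top sequentially"
    and a: "(\<lambda>n. card (A n) / card (pverts (G n))) \<longlonglongrightarrow> a"
  shows "(\<lambda>n. hom_density F (G n)) \<longlonglongrightarrow> split_poly F a"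
proof -
  let ?N = "\<lambda>n. card (pverts (G n))"
  have "eventually (\<lambda>n. 1 \<le> ?N n) sequentially"
    using card by (simp add: filterlim_at_top)
  then have "eventually (\<lambda>n. norm (hom_density F (G n) - split_poly F (card (A n) / ?N n))
      \<le> (card (pverts F))\<^sup>2 / ?N n) sequentially"
  proof eventually_elim
    case (elim n)
    \<comment> \<open>Infinite sets have \<open>card\<close> 0, so positive cardinality yields
      finiteness as well as nonemptiness.\<close>
    then have "finite (pverts (G n))" "pverts (G n) \<noteq> {}"
      by (metis card.infinite not_one_le_zero, force)
    then show ?case using hom_density_two_clique[OF F _ _ G] by simp
  qed
  moreover have "(\<lambda>n. (card (pverts F))\<^sup>2 / ?N n) \<longlonglongrightarrow> 0"
    by (intro tendsto_divide_0[OF tendsto_const] filterlim_at_top_imp_at_infinity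
        filterlim_compose[OF filterlim_real_sequentially card])
  ultimately have "(\<lambda>n. hom_density F (G n) - split_poly F (card (A n) / ?N n)) \<longlonglongrightarrow> 0"
    by (rule Lim_null_comparison)
  moreover have "(\<lambda>n. split_poly F (card (A n) / ?N n)) \<longlonglongrightarrow> split_poly F a"
    by (rule isCont_tendsto_compose[OF isCont_split_poly[OF F] a])
  ultimately show ?thesis using tendsto_add by fastforce
qed

lemma represents_two_clique_iff:
  assumes "a \<in> {0..1}"
  shows "represents (two_clique_graphon a) \<Gamma> \<longleftrightarrow> (\<forall>F \<in> finite_graphs. \<Gamma> F = split_poly F a)"
  using assms by (simp add: represents_def graphon_two_clique graphon_density_two_clique)

text \<open>The proportion of vertices in the first clique converges to some \<open>a\<close> along
  a subsequence, by compactness. The densities already converge along the full sequence, so their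
  limits are those found on the subsequence.\<close>

lemma class_limits_two_clique_represents:
  assumes "\<Gamma> \<in> class_limits two_clique_graphs"
  obtains a where "a \<in> {0..1}" "represents (two_clique_graphon a) \<Gamma>"
proof -
  obtain G where G: "\<And>n::nat. G n \<in> two_clique_graphs"
    and card: "filterlim (\<lambda>n. card (pverts (G n))) at_top sequentially"
    and lim: "\<And>F. F \<in> finite_graphs \<Longrightarrow> (\<lambda>n. hom_density F (G n)) \<longlonglongrightarrow> \<Gamma> F"
    using assms by (auto simp: class_limits_def)
  define P where "P n A B \<longleftrightarrow> A \<inter> B = {} \<and> pverts (G n) = A \<union> B \<and>
      parcs (G n) = {(u, v). u \<noteq> v \<and> (u \<in> A \<and> v \<in> A \<or> u \<in> B \<and> v \<in> B)}" for n A B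
  have "\<forall>n. \<exists>A B. P n A B"
    using G unfolding two_clique_graphs_def P_def by blast
  then obtain A B where "\<And>n. P n (A n) (B n)" by metis
  then have AB: "\<And>n. A n \<inter> B n = {}" "\<And>n. pverts (G n) = A n \<union> B n"
    "\<And>n. parcs (G n) = {(u, v). u \<noteq> v \<and> (u \<in> A n \<and> v \<in> A n \<or> u \<in> B n \<and> v \<in> B n)}"
    unfolding P_def by blast+
  define s where "s n = card (A n) / card (pverts (G n))" for n
  have "s n \<in> {0..1}" for n
  proof -
    have "finite (pverts (G n))"
      using G[of n] by (auto simp: two_clique_graphs_def finite_graphsD)
    then have "card (A n) \<le> card (pverts (G n))"
      unfolding AB(2) by (intro card_mono) auto
    then show ?thesis by (auto simp: s_def divide_le_eq_1)
  qed
  moreover have "seq_compact {0..1::real}"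
    by (intro compact_imp_seq_compact compact_Icc)
  ultimately obtain a r where a: "a \<in> {0..1}" and r: "strict_mono r" "(s \<circ> r) \<longlonglongrightarrow> a"
    by (metis seq_compactE)
  have r_lim: "filterlim r at_top sequentially" using r(1) by (rule filterlim_subseq)
  have "\<Gamma> F = split_poly F a" if F: "F \<in> finite_graphs" for F
  proof (rule LIMSEQ_unique)
    show "(\<lambda>n. hom_density F (G (r n))) \<longlonglongrightarrow> \<Gamma> F"
      by (rule filterlim_compose[OF lim[OF F] r_lim])
    show "(\<lambda>n. hom_density F (G (r n))) \<longlonglongrightarrow> split_poly F a"
      using r(2) by (intro tendsto_hom_density_two_clique[OF F AB] filterlim_compose[OF card r_lim])
        (simp add: s_def o_def)
  qed
  with a that show thesis by (simp add: represents_two_clique_iff)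
qed

text \<open>The witness on \<open>n\<close> vertices has cliques of orders
  \<open>nat \<lfloor>a * n\<rfloor>\<close> and \<open>n - nat \<lfloor>a * n\<rfloor>\<close>, so
  the first clique has proportion within \<open>1 / n\<close> of \<open>a\<close>.\<close>

lemma represents_two_clique_class_limits:
  assumes \<Gamma>: "\<Gamma> \<in> extensional finite_graphs"
    and a: "a \<in> {0..1}" "represents (two_clique_graphon a) \<Gamma>"
  shows "\<Gamma> \<in> class_limits two_clique_graphs"
proof -
  define A where "A n = {..<nat \<lfloor>a * n\<rfloor>}" for n
  define B where "B n = {nat \<lfloor>a * n\<rfloor>..<n}" for n
  define G where "G n = \<lparr>pverts = A n \<union> B n,
    parcs = {(u, v). u \<noteq> v \<and> (u \<in> A n \<and> v \<in> A n \<or> u \<in> B n \<and> v \<in> B n)}\<rparr>" for n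
  have "nat \<lfloor>a * n\<rfloor> \<le> n" for n
  proof -
    have "a * n \<le> n" using a by (simp add: mult_left_le_one_le)
    then show ?thesis by linarith
  qed
  then have verts: "A n \<union> B n = {..<n}" for n by (simp add: A_def B_def ivl_disj_un)
  have disj: "A n \<inter> B n = {}" for n by (auto simp: A_def B_def)
  have G: "G n \<in> two_clique_graphs" for n
  proof -
    have "G n \<in> finite_graphs"
      unfolding G_def by (rule finite_graphsI) (auto simp: verts sym_def irrefl_def A_def B_def)
    then show ?thesis
      using disj unfolding two_clique_graphs_def by (auto simp: G_def)
  qed
  have card: "card (pverts (G n)) = n" for n by (simp add: G_def verts)
  have "(\<lambda>n. real (nat \<lfloor>a * n\<rfloor>) / n) \<longlonglongrightarrow> a"
  proof (rule tendsto_sandwich)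
    show "(\<lambda>n. a - 1 / real n) \<longlonglongrightarrow> a" by real_asymp
    show "\<forall>\<^sub>F n in sequentially. a - 1 / n \<le> real (nat \<lfloor>a * n\<rfloor>) / n"
      using eventually_gt_at_top[of 0]
    proof eventually_elim
      case (elim n)
      have "a * n - 1 \<le> real (nat \<lfloor>a * n\<rfloor>)" using a by linarith
      then have "(a * n - 1) / n \<le> real (nat \<lfloor>a * n\<rfloor>) / n" by (rule divide_right_mono) simp
      then show ?case using elim by (simp add: diff_divide_distrib)
    qed
    show "\<forall>\<^sub>F n in sequentially. real (nat \<lfloor>a * n\<rfloor>) / n \<le> a"
      using eventually_gt_at_top[of 0]
    proof eventually_elim
      case (elim n)
      have "real (nat \<lfloor>a * n\<rfloor>) \<le> a * n" using a by (intro of_nat_floor) simp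
      then show ?case using elim by (simp add: field_simps)
    qed
  qed simp
  then have ratio: "(\<lambda>n. card (A n) / card (pverts (G n))) \<longlonglongrightarrow> a" by (simp add: card A_def)
  have card_lim: "filterlim (\<lambda>n. card (pverts (G n))) at_top sequentially"
    by (simp add: card filterlim_ident)
  have "(\<lambda>n. hom_density F (G n)) \<longlonglongrightarrow> \<Gamma> F" if F: "F \<in> finite_graphs" for F
    using tendsto_hom_density_two_clique[OF F disj _ _ card_lim ratio] a F
    by (simp add: G_def represents_two_clique_iff)
  with \<Gamma> G card_lim show ?thesis by (auto simp: class_limits_def)
qed

theorem theorem1p8:
  fixes \<Gamma> :: "nat pair_pre_digraph \<Rightarrow> real"
  assumes "\<Gamma> \<in> graph_limits"
  shows "\<Gamma> \<in> max_entropy_limits two_clique_graphs \<longleftrightarrow>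
           (\<exists>a \<in> {0..1}. represents (two_clique_graphon a) \<Gamma>)"
proof -
  \<comment> \<open>\<open>represents\<close> fixes \<Gamma> only on finite graphs; membership in
    \<open>class_limits\<close> also asks for the default value elsewhere.\<close>
  have ext: "\<Gamma> \<in> extensional finite_graphs"
    using assms by (simp add: graph_limits_def class_limits_def)
  have "limit_entropy \<Delta> = 0" if "\<Delta> \<in> class_limits two_clique_graphs" for \<Delta>
    using class_limits_two_clique_represents[OF that] limit_entropy_two_clique by metis
  \<comment> \<open>The entropy is constant on the class limits, so each of them attains the
    maximum.\<close>
  then have "max_entropy_limits two_clique_graphs = class_limits two_clique_graphs"
    by (auto simp: max_entropy_limits_def)
  then show ?thesis
    using class_limits_two_clique_represents represents_two_clique_class_limits[OF ext] by metis
qed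

end
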